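(* Let $A\in\mathbb{C}^{q\times n}$, let $W\in\mathbb{C}^{n\times q}$ with $W\neq 0$, let $m$ be a positive integer and $k=\max\{\mathrm{Ind}(AW),\mathrm{Ind}(WA)\}$. Then the $W$-weighted $m$-weak group inverse $A^{\mathrm{wg}_m,W}$ of $A$ satisfies: (1) if $k\ge m$, then $A^{\mathrm{wg}_m,W}=A^{\star(k-m)}W\left(A^{\star(k+1)}\right)^{\mathrm{core},W}WA^{\star m}$; (2) if $k\ge m+1$, then $A^{\mathrm{wg}_m,W}=A^{\star(k-m-1)}W\left(A^{\star k}\right)^{\mathrm{core},W}WA^{\star m}$.
   Context: Notation: $\mathcal{R}(B)$ is the range (column space) of $B$. For square $B$, $B^0=I$ and $\mathrm{Ind}(B)$ is the smallest integer $j\ge 0$ with $\mathrm{rank}(B^{j})=\mathrm{rank}(B^{j+1})$. $P_{\mathcal{T}}$ is the orthogonal projector onto the subspace $\mathcal{T}$. $W$-product: for $X,Y\in\mathbb{C}^{q\times n}$, $X\star Y=XWY$, and $X^{\star l}=X\star\cdots\star X$ ($l$ factors) for $l\ge 1$. Convention for exponent zero: $X^{\star 0}W=I_q$ and $WX^{\star 0}=I_n$. Weighted core-EP inverse: for $C\in\mathbb{C}^{q\times n}$ with $k_C=\max\{\mathrm{Ind}(CW),\mathrm{Ind}(WC)\}$, $C^{\mathrm{cEP},W}\in\mathbb{C}^{q\times n}$ is the unique matrix $X$ with $WCWX=P_{\mathcal{R}((WC)^{k_C})}$ and $\mathcal{R}(X)\subseteq\mathcal{R}((CW)^{k_C})$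 (existence and uniqueness are known). When $k_C\le 1$ it is called the weighted core inverse of $C$ and denoted $C^{\mathrm{core},W}$. $W$-weighted $m$-weak group inverse: $A^{\mathrm{wg}_m,W}=(A^{\mathrm{cEP},W})^{\star(m+1)}\,W\,A^{\star m}$. *)

theory Defs
  imports "HOL-Analysis.Analysis"
begin

(* A q x n complex matrix has type complex^'n^'q (the row index is the outer one).  The library's
   times and power on vectors are componentwise, hence a separate power of square matrices. *)

primrec mat_power :: "complex^'n^'n \<Rightarrow> nat \<Rightarrow> complex^'n^'n" where
  "mat_power B 0 = mat 1"
| "mat_power B (Suc j) = mat_power B j ** B"

definition mat_index :: "complex^'n^'n \<Rightarrow> nat" where
  "mat_index B = (LEAST j. rank (mat_power B j) = rank (mat_power B (Suc j)))"

definition mat_range :: "complex^'n^'m \<Rightarrow> (complex^'m) set" where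
  "mat_range B = range (\<lambda>x. B *v x)"

(* The Hermitian inner product; the library's inner on complex^'n is only its real part. *)
definition hermitian_inner :: "complex^'n \<Rightarrow> complex^'n \<Rightarrow> complex" where
  "hermitian_inner x y = (\<Sum>i\<in>UNIV. x $ i * cnj (y $ i))"

definition orth_projector :: "(complex^'n) set \<Rightarrow> complex^'n^'n" where
  "orth_projector T =
     (THE P. \<forall>x. P *v x \<in> T \<and> (\<forall>y\<in>T. hermitian_inner (x - P *v x) y = 0))"

definition wprod :: "complex^'q^'n \<Rightarrow> complex^'n^'q \<Rightarrow> complex^'n^'q \<Rightarrow> complex^'n^'q" where
  "wprod W X Y = X ** W ** Y"

(* Only exponents l >= 1 are specified: for l = 0 the power by itself has no meaning. *)
fun wpow :: "complex^'q^'n \<Rightarrow> complex^'n^'q \<Rightarrow> nat \<Rightarrow> complex^'n^'q" where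
  "wpow W X (Suc 0) = X"
| "wpow W X (Suc (Suc l)) = wprod W (wpow W X (Suc l)) X"

(* The l-th W-power of X followed by W, under the convention that this is the q x q identity
   for l = 0.  The mirrored convention, for W followed by a zeroth W-power, is not needed:
   wherever W precedes a W-power below, the exponent is positive. *)
definition wpow_times_W :: "complex^'q^'n \<Rightarrow> complex^'n^'q \<Rightarrow> nat \<Rightarrow> complex^'q^'q" where
  "wpow_times_W W X l = (if l = 0 then mat 1 else wpow W X l ** W)"

definition windex :: "complex^'q^'n \<Rightarrow> complex^'n^'q \<Rightarrow> nat" where
  "windex W C = max (mat_index (C ** W)) (mat_index (W ** C))"

definition is_weighted_core_EP :: "complex^'q^'n \<Rightarrow> complex^'n^'q \<Rightarrow> complex^'n^'q \<Rightarrow> bool" where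
  "is_weighted_core_EP W C X \<longleftrightarrow>
     W ** C ** W ** X = orth_projector (mat_range (mat_power (W ** C) (windex W C))) \<and>
     mat_range X \<subseteq> mat_range (mat_power (C ** W) (windex W C))"

definition weighted_core_EP_inverse :: "complex^'q^'n \<Rightarrow> complex^'n^'q \<Rightarrow> complex^'n^'q" where
  "weighted_core_EP_inverse W C = (THE X. is_weighted_core_EP W C X)"

(* Unspecified unless the weighted index of C is at most 1, so an equation about it
   also requires its existence. *)
definition weighted_core_inverse :: "complex^'q^'n \<Rightarrow> complex^'n^'q \<Rightarrow> complex^'n^'q" where
  "weighted_core_inverse W C = (THE X. windex W C \<le> 1 \<and> is_weighted_core_EP W C X)"

(* For m >= 1. *)
definition weighted_weak_group_inverse ::
    "nat \<Rightarrow> complex^'q^'n \<Rightarrow> complex^'n^'q \<Rightarrow> complex^'n^'q" where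
  "weighted_weak_group_inverse m W A =
     wpow W (weighted_core_EP_inverse W A) (m + 1) ** W ** wpow W A m"

end

theory Submission
  imports Defs
begin

text \<open>
  Let \<open>X\<close> be the weighted core-EP inverse of \<open>A\<close> and \<open>k\<close> the weighted index of \<open>A\<close>. Both
  formulas are one statement, read at \<open>l = k + 1\<close> and at \<open>l = k\<close>: whenever \<open>l \<ge> k\<close> and
  \<open>l \<ge> m + 1\<close>, the first factor \<open>X\<^bsup>\<star>(m+1)\<^esup>\<close> of the weak group inverse equals
  \<open>(AW)^(l-m-1) V\<close>, where \<open>V\<close> is the weighted core inverse of the \<open>l\<close>-th W-power of \<open>A\<close>.
  Two facts give this.

  First, \<open>V\<close> is the \<open>l\<close>-th W-power of \<open>X\<close> (lemma \<open>weighted_core_inverse_wpow\<close>). The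
  \<open>l\<close>-th W-power \<open>C\<close> of \<open>A\<close> satisfies \<open>CW = (AW)^l\<close> and \<open>WC = (WA)^l\<close>, so for \<open>l \<ge> k\<close> its
  weighted index is at most 1, and the ranges that define its core-EP inverse are those
  that define \<open>X\<close>. That \<open>WCW\<close> times the \<open>l\<close>-th W-power of \<open>X\<close> is the required projector
  \<open>WAWX\<close> is a consequence of the second fact.

  Second, \<open>AWXWX = X\<close> (lemma \<open>weighted_core_EP_cancel_AW\<close>), so that each factor \<open>AW\<close> on
  the left of a W-power of \<open>X\<close> cancels one factor of that power. This follows from
  uniqueness: the columns of \<open>WX\<close> lie in the range onto which \<open>WAWX\<close> projects, so both
  sides have the same image under \<open>WAW\<close>.

  Since inverses and projectors are given by definite descriptions, existence and
  uniqueness have to be shown as well. For the inverses they rest on the stabilization of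
  the row spaces and of the ranges of powers of a square matrix from its index on, for the
  projectors on orthogonal decomposition.
\<close>

section \<open>Powers and W-powers\<close>

lemma mat_power_add: "mat_power B (i + j) = mat_power B i ** mat_power B j"
  by (induction j) (simp_all add: matrix_mul_assoc)

lemma mat_power_Suc_left: "mat_power B (Suc j) = B ** mat_power B j"
  using mat_power_add[of B 1 j] by simp

lemma mat_power_mult: "mat_power (mat_power B l) j = mat_power B (l * j)"
  by (induction j) (simp_all add: mat_power_add[symmetric] add.commute)

lemma mat_power_intertwine:
  "W ** mat_power (A ** W) j = mat_power (W ** A) j ** W"
  by (induction j) (simp_all add: matrix_mul_assoc)

lemma wpow_eq_mat_power_mult: "wpow W A (Suc l) = mat_power (A ** W) l ** A"
  by (induction l) (simp_all add: wprod_def matrix_mul_assoc)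

lemma wpow_eq_mult_mat_power: "wpow W A (Suc l) = A ** mat_power (W ** A) l"
  by (simp add: wpow_eq_mat_power_mult mat_power_intertwine)

lemma wpow_mult_weight: "l \<ge> 1 \<Longrightarrow> wpow W A l ** W = mat_power (A ** W) l"
  by (cases l) (simp_all add: wpow_eq_mat_power_mult matrix_mul_assoc)

lemma weight_mult_wpow: "l \<ge> 1 \<Longrightarrow> W ** wpow W A l = mat_power (W ** A) l"
  by (cases l) (simp_all add: wpow_eq_mult_mat_power matrix_mul_assoc mat_power_Suc_left del: mat_power.simps)

lemma wpow_times_W_eq_mat_power: "wpow_times_W W A l = mat_power (A ** W) l"
  by (simp add: wpow_times_W_def wpow_mult_weight)

section \<open>Ranges, ranks and the index\<close>

lemma subspace_mat_range: "vec.subspace (mat_range (B :: complex^'n^'m))"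
  unfolding mat_range_def
  by (rule vec.linear_subspace_image[OF matrix_vector_mul_linear_gen vec.subspace_UNIV])

lemma mat_range_mult_subset: "mat_range (M ** N) \<subseteq> mat_range M"
  by (auto simp: mat_range_def matrix_vector_mul_assoc[symmetric])

lemma column_in_mat_range: "column j M \<in> mat_range M" for M :: "complex^'n^'m"
proof -
  have "column j M = M *v axis j 1"
    by (simp add: vec_eq_iff column_def matrix_vector_mult_def axis_def if_distrib cong: if_cong)
  then show ?thesis by (simp add: mat_range_def)
qed

lemma mat_range_subset_iff_factor:
  "mat_range (M :: complex^'p^'m) \<subseteq> mat_range (N :: complex^'n^'m) \<longleftrightarrow> (\<exists>Z. M = N ** Z)"
proof
  assume sub: "mat_range M \<subseteq> mat_range N"
  have "\<forall>j. \<exists>z. column j M = N *v z"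
    using sub column_in_mat_range[of _ M] unfolding mat_range_def by (metis imageE subsetD)
  then obtain z where z: "\<And>j. column j M = N *v z j" by metis
  have "M = N ** (\<chi> i j. z j $ i)"
    using z by (simp add: vec_eq_iff column_def matrix_matrix_mult_def matrix_vector_mult_def)
  then show "\<exists>Z. M = N ** Z" ..
next
  assume "\<exists>Z. M = N ** Z"
  then show "mat_range M \<subseteq> mat_range N" using mat_range_mult_subset by auto
qed

lemma mat_range_eq_span_columns: "mat_range (M :: complex^'n^'m) = vec.span (columns M)"
proof
  show "mat_range M \<subseteq> vec.span (columns M)"
    by (auto simp: mat_range_def matrix_vector_mult_in_columnspace_gen)
  have "columns M \<subseteq> mat_range M"
    by (auto simp: columns_def column_in_mat_range)
  then show "vec.span (columns M) \<subseteq> mat_range M"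
    by (rule vec.span_minimal[OF _ subspace_mat_range])
qed

text \<open>
  The rank is defined as the dimension of the row space; expressing it by the range of
  the transpose reduces statements about rows to statements about ranges.
\<close>
lemma rank_eq_dim_range_transpose: "rank (M :: complex^'n^'m) = vec.dim (mat_range (transpose M))"
  by (simp add: mat_range_eq_span_columns row_rank_def_gen columns_transpose vec.dim_span)

lemma mat_range_transpose_mult_subset:
  "mat_range (transpose (Y ** M)) \<subseteq> mat_range (transpose M)"
  for M :: "complex^'n^'m"
  by (simp add: matrix_transpose_mul mat_range_mult_subset)

lemma rank_left_mult_le: "rank (Y ** M) \<le> rank M" for M :: "complex^'n^'m"
  unfolding rank_eq_dim_range_transpose
  by (rule vec.dim_subset[OF mat_range_transpose_mult_subset])

text \<open>
  The row space of \<open>Y ** M\<close> lies in that of \<open>M\<close>; if the dimensions agree, the two spaces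
  are equal, and so the rows of \<open>M\<close> are combinations of those of \<open>Y ** M\<close>.
\<close>
lemma left_factor_if_rank_le:
  fixes M :: "complex^'n^'m" and Y :: "complex^'m^'p"
  assumes "rank M \<le> rank (Y ** M)"
  shows "\<exists>Z. M = Z ** (Y ** M)"
proof -
  have "mat_range (transpose (Y ** M)) = mat_range (transpose M)"
    using assms unfolding rank_eq_dim_range_transpose
    by (intro vec.subspace_dim_equal[OF subspace_mat_range subspace_mat_range mat_range_transpose_mult_subset])
  then obtain Z where "transpose M = transpose (Y ** M) ** Z"
    using mat_range_subset_iff_factor by blast
  then have "M = transpose Z ** (Y ** M)"
    by (metis matrix_transpose_mul transpose_transpose)
  then show ?thesis ..
qed

text \<open>
  The ranks of successive powers form a decreasing sequence of natural numbers, which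
  cannot be strictly decreasing, so the least exponent in the definition of the index
  exists.
\<close>
lemma rank_mat_index:
  "rank (mat_power B (mat_index B)) = rank (mat_power B (Suc (mat_index B)))"
proof -
  have dec: "rank (mat_power B (Suc j)) \<le> rank (mat_power B j)" for j
    unfolding mat_power_Suc_left by (rule rank_left_mult_le)
  have "\<exists>j. rank (mat_power B j) = rank (mat_power B (Suc j))"
  proof (rule ccontr)
    assume "\<nexists>j. rank (mat_power B j) = rank (mat_power B (Suc j))"
    then have less: "rank (mat_power B (Suc j)) < rank (mat_power B j)" for j
      using dec[of j] by (metis le_neq_implies_less)
    have "rank (mat_power B j) + j \<le> rank (mat_power B 0)" for j
    proof (induction j)
      case (Suc j)
      then show ?case using less[of j] by linarith
    qed simp
    from this[of "Suc (rank (mat_power B 0))"] show False by simp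
  qed
  then show ?thesis unfolding mat_index_def by (rule LeastI_ex)
qed

text \<open>
  Stabilization of the row spaces, as an equation: \<open>B^j M\<close> determines \<open>B^i M\<close> for every
  \<open>M\<close>, so that extra left factors \<open>B\<close> can be cancelled.
\<close>
lemma mat_power_left_factor:
  assumes "mat_index B \<le> i" "i \<le> j"
  shows "\<exists>Y. mat_power B i = Y ** mat_power B j"
  using assms(2)
proof (induction j rule: dec_induct)
  case base
  show ?case by (metis matrix_mul_lid)
next
  case (step j)
  obtain Y where Y: "mat_power B i = Y ** mat_power B j" using step by blast
  obtain Z where Z: "mat_power B (mat_index B) = Z ** mat_power B (Suc (mat_index B))"
    using left_factor_if_rank_le[of "mat_power B (mat_index B)" B] rank_mat_index[of B]
    unfolding mat_power_Suc_left by auto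
  have "mat_power B j = mat_power B (mat_index B) ** mat_power B (j - mat_index B)"
    using assms(1) step by (simp flip: mat_power_add)
  also have "\<dots> = Z ** mat_power B (Suc (mat_index B) + (j - mat_index B))"
    unfolding mat_power_add by (subst Z) (simp add: matrix_mul_assoc)
  also have "Suc (mat_index B) + (j - mat_index B) = Suc j"
    using assms(1) step by simp
  finally show ?case using Y by (metis matrix_mul_assoc)
qed

text \<open>
  Stabilization of the ranges follows from that of the row spaces: by the left
  factorization, the power \<open>B^(j-i)\<close> is injective on the range of \<open>B^i\<close>, and it maps this
  range onto that of \<open>B^j\<close>, so the two have the same dimension.
\<close>
lemma mat_range_power_stable:
  assumes "mat_index B \<le> i" "i \<le> j"
  shows "mat_range (mat_power B j) = mat_range (mat_power B i)"
proof (rule vec.subspace_dim_equal[OF subspace_mat_range subspace_mat_range])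
  let ?b = "mat_power B (j - i)"
  have j: "mat_power B j = ?b ** mat_power B i"
    using assms(2) by (simp flip: mat_power_add)
  have j': "mat_power B j = mat_power B i ** ?b"
    using assms(2) by (simp flip: mat_power_add)
  show "mat_range (mat_power B j) \<subseteq> mat_range (mat_power B i)"
    unfolding j' by (rule mat_range_mult_subset)
  obtain Y where Y: "mat_power B i = Y ** mat_power B j"
    using mat_power_left_factor[OF assms] by blast
  have "inj_on ((*v) ?b) (mat_range (mat_power B i))"
  proof (rule inj_on_inverseI)
    fix x assume "x \<in> mat_range (mat_power B i)"
    then obtain y where y: "x = mat_power B i *v y" by (auto simp: mat_range_def)
    show "Y *v (?b *v x) = x"
      unfolding y matrix_vector_mul_assoc by (metis Y j matrix_mul_assoc)
  qed
  then have "vec.dim ((*v) ?b ` mat_range (mat_power B i)) = vec.dim (mat_range (mat_power B i))"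
    by (intro vec.dim_image_eq[OF matrix_vector_mul_linear_gen])
      (simp add: vec.span_eq_iff[THEN iffD2, OF subspace_mat_range])
  moreover have "(*v) ?b ` mat_range (mat_power B i) = mat_range (mat_power B j)"
    unfolding j by (auto simp: mat_range_def matrix_vector_mul_assoc[symmetric] image_image)
  ultimately show "vec.dim (mat_range (mat_power B i)) \<le> vec.dim (mat_range (mat_power B j))" by simp
qed

text \<open>
  The powers \<open>B^l\<close> and \<open>B^(2l)\<close> have the same row space when \<open>l\<close> is at least the index.
\<close>
lemma mat_index_power_le_1:
  assumes "mat_index B \<le> l"
  shows "mat_index (mat_power B l) \<le> 1"
  unfolding mat_index_def
proof (rule Least_le)
  obtain Y where Y: "mat_power B l = Y ** mat_power B (l + l)"
    using mat_power_left_factor[OF assms] le_add1 by blast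
  have "rank (mat_power B l) \<le> rank (mat_power B (l + l))"
    by (subst Y) (rule rank_left_mult_le)
  moreover have "rank (mat_power B (l + l)) \<le> rank (mat_power B l)"
    unfolding mat_power_add by (rule rank_left_mult_le)
  ultimately show "rank (mat_power (mat_power B l) 1) = rank (mat_power (mat_power B l) (Suc 1))"
    by (simp add: mat_power_mult mat_power_add)
qed

section \<open>Hermitian orthogonal projectors\<close>

lemma hermitian_inner_diff_left:
  "hermitian_inner (x - y) z = hermitian_inner x z - hermitian_inner y z"
  by (simp add: hermitian_inner_def algebra_simps sum_subtractf)

lemma hermitian_inner_add_left:
  "hermitian_inner (x + y) z = hermitian_inner x z + hermitian_inner y z"
  by (simp add: hermitian_inner_def algebra_simps sum.distrib)

lemma hermitian_inner_scale_left: "hermitian_inner (c *s x) z = c * hermitian_inner x z"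
  by (simp add: hermitian_inner_def algebra_simps sum_distrib_left)

lemma hermitian_inner_scale_right: "hermitian_inner x (c *s z) = cnj c * hermitian_inner x z"
  by (simp add: hermitian_inner_def algebra_simps sum_distrib_left)

lemma inner_eq_Re_hermitian_inner: "inner x y = Re (hermitian_inner x y)"
  by (simp add: inner_vec_def hermitian_inner_def inner_complex_def)

lemma hermitian_inner_self_eq_0: "hermitian_inner x x = 0 \<Longrightarrow> x = 0"
  by (metis inner_eq_Re_hermitian_inner inner_eq_zero_iff zero_complex.sel(1))

text \<open>
  The decomposition comes from the real inner product, which is the real part of the
  Hermitian one. As \<open>T\<close> is closed under multiplication by \<open>\<i>\<close>, real orthogonality to
  \<open>\<i> z\<close> makes the imaginary part of the Hermitian product with \<open>z\<close> vanish too.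
\<close>
lemma orthogonal_decomposition_exists:
  fixes T :: "(complex^'n) set"
  assumes T: "vec.subspace T"
  shows "\<exists>y\<in>T. \<forall>z\<in>T. hermitian_inner (x - y) z = 0"
proof -
  have "subspace T"
    using T vec.subspace_scale[OF T, of "of_real c" for c]
    by (auto simp: vec.subspace_def subspace_def vector_scalar_mult_def scaleR_vec_def scaleR_conv_of_real)
  obtain y w where y: "y \<in> span T" and w: "\<And>u. u \<in> span T \<Longrightarrow> orthogonal w u" and x: "x = y + w"
    using orthogonal_subspace_decomp_exists[of T x] by metis
  have [simp]: "span T = T" using \<open>subspace T\<close> by (simp add: span_eq_iff)
  have "hermitian_inner (x - y) z = 0" if z: "z \<in> T" for z
  proof (rule complex_eqI)
    show "Re (hermitian_inner (x - y) z) = Re 0"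
      using w[of z] z x by (simp add: orthogonal_def inner_eq_Re_hermitian_inner)
    have "\<i> *s z \<in> T" using T z by (rule vec.subspace_scale)
    then show "Im (hermitian_inner (x - y) z) = Im 0"
      using w[of "\<i> *s z"] x
      by (simp add: orthogonal_def inner_eq_Re_hermitian_inner hermitian_inner_scale_right)
  qed
  then show ?thesis using y by auto
qed

lemma orthogonal_decomposition_unique:
  fixes T :: "(complex^'n) set"
  assumes T: "vec.subspace T"
    and "y \<in> T" "\<forall>z\<in>T. hermitian_inner (x - y) z = 0"
    and "y' \<in> T" "\<forall>z\<in>T. hermitian_inner (x - y') z = 0"
  shows "y = y'"
proof -
  have "y - y' \<in> T" using assms vec.subspace_diff by blast
  then have "hermitian_inner ((x - y') - (x - y)) (y - y') = 0"
    using assms(3,5) by (simp only: hermitian_inner_diff_left[of "x - y'"]) simp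
  then show ?thesis using hermitian_inner_self_eq_0[of "y - y'"] by simp
qed

text \<open>
  Uniqueness of the orthogonal decomposition makes the component in \<open>T\<close> a linear function
  of \<open>x\<close>; its matrix is the projector.
\<close>
lemma orth_projector_characterization:
  fixes T :: "(complex^'n) set"
  assumes T: "vec.subspace T"
  shows "orth_projector T *v x \<in> T"
    and "z \<in> T \<Longrightarrow> hermitian_inner (x - orth_projector T *v x) z = 0"
proof -
  let ?Q = "\<lambda>P :: complex^'n^'n. \<forall>x. P *v x \<in> T \<and> (\<forall>y\<in>T. hermitian_inner (x - P *v x) y = 0)"
  obtain f where f: "\<And>x. f x \<in> T" "\<And>x z. z \<in> T \<Longrightarrow> hermitian_inner (x - f x) z = 0"
    using orthogonal_decomposition_exists[OF T] by metis
  have eq: "f x = y" if "y \<in> T" "\<forall>z\<in>T. hermitian_inner (x - y) z = 0" for x y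
    using orthogonal_decomposition_unique[OF T f(1) _ that] f(2) by blast
  have "Vector_Spaces.linear (*s) (*s) f"
  proof (unfold_locales, goal_cases)
    case (1 x y)
    have "x + y - (f x + f y) = (x - f x) + (y - f y)" by simp
    then have "hermitian_inner (x + y - (f x + f y)) z = 0" if "z \<in> T" for z
      by (metis hermitian_inner_add_left f(2)[OF that] add_0)
    then show ?case by (intro eq vec.subspace_add[OF T] f(1)) blast
  next
    case (2 c x)
    have "c *s x - c *s f x = c *s (x - f x)" by (rule vec.scale_right_diff_distrib[symmetric])
    then have "hermitian_inner (c *s x - c *s f x) z = 0" if "z \<in> T" for z
      by (metis hermitian_inner_scale_left f(2)[OF that] mult_zero_right)
    then show ?case by (intro eq vec.subspace_scale[OF T] f(1)) blast
  qed
  then have "matrix f *v x = f x" for x by (rule matrix_works)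
  then have "?Q (matrix f)" using f by simp
  moreover have "P = matrix f" if "?Q P" for P
    using that eq \<open>\<And>x. matrix f *v x = f x\<close> by (metis matrix_eq)
  ultimately have "?Q (orth_projector T)"
    unfolding orth_projector_def by (rule theI)
  then show "orth_projector T *v x \<in> T"
    and "z \<in> T \<Longrightarrow> hermitian_inner (x - orth_projector T *v x) z = 0" by auto
qed

lemma orth_projector_fixes:
  assumes T: "vec.subspace T" and "x \<in> T"
  shows "orth_projector T *v x = x"
proof (rule orthogonal_decomposition_unique[OF T _ _ \<open>x \<in> T\<close>])
  show "\<forall>z\<in>T. hermitian_inner (x - x) z = 0" by (simp add: hermitian_inner_def)
qed (simp_all add: orth_projector_characterization[OF T])

lemma orth_projector_mult_absorb:
  fixes M :: "complex^'p^'m" and N :: "complex^'n^'m"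
  assumes "mat_range M \<subseteq> mat_range N"
  shows "orth_projector (mat_range N) ** M = M"
proof -
  have "(orth_projector (mat_range N) ** M) *v x = M *v x" for x
    using assms orth_projector_fixes[OF subspace_mat_range, of "M *v x" N]
    by (auto simp: matrix_vector_mul_assoc[symmetric] mat_range_def)
  then show ?thesis by (simp add: matrix_eq)
qed

section \<open>The weighted core-EP inverse\<close>

text \<open>
  Any upper bound of the index may take its place, which allows comparing the core-EP
  inverses of matrices with different indices.
\<close>
lemma is_weighted_core_EP_iff:
  assumes "windex W C \<le> N"
  shows "is_weighted_core_EP W C X \<longleftrightarrow>
     W ** C ** W ** X = orth_projector (mat_range (mat_power (W ** C) N)) \<and>
     mat_range X \<subseteq> mat_range (mat_power (C ** W) N)"
  using mat_range_power_stable[of "W ** C" "windex W C" N] mat_range_power_stable[of "C ** W" "windex W C" N] assms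
  unfolding is_weighted_core_EP_def by (simp add: windex_def)

text \<open>
  On the range of \<open>(CW)^k\<close> the matrix \<open>WCW\<close> is injective: already \<open>C(WCW) = (CW)^2\<close> is
  injective there, because \<open>(CW)^(k+2)\<close> has the same row space as \<open>(CW)^k\<close>.
\<close>
lemma weighted_core_EP_determined:
  fixes X :: "complex^'n^'q"
  assumes X: "mat_range X \<subseteq> mat_range (mat_power (C ** W) (windex W C))"
    and Y: "mat_range Y \<subseteq> mat_range (mat_power (C ** W) (windex W C))"
    and eq: "W ** C ** W ** X = W ** C ** W ** Y"
  shows "X = Y"
proof -
  let ?k = "windex W C"
  let ?b = "mat_power (C ** W)"
  obtain X' where X': "X = ?b ?k ** X'" using X mat_range_subset_iff_factor by blast
  obtain Y' where Y': "Y = ?b ?k ** Y'" using Y mat_range_subset_iff_factor by blast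
  have "mat_index (C ** W) \<le> ?k" by (simp add: windex_def)
  then obtain Z where Z: "?b ?k = Z ** ?b (2 + ?k)"
    using mat_power_left_factor[OF _ le_add2] by blast
  have two: "C ** (W ** C ** W ** V) = ?b 2 ** V" for V
    by (simp add: numeral_2_eq_2 matrix_mul_assoc)
  have recover: "Z ** (?b 2 ** (?b ?k ** V)) = ?b ?k ** V" for V
    by (metis Z mat_power_add matrix_mul_assoc)
  have "X = Z ** (?b 2 ** X)" unfolding X' by (rule recover[symmetric])
  also have "\<dots> = Z ** (?b 2 ** Y)" using eq by (simp flip: two)
  also have "\<dots> = Y" unfolding Y' by (rule recover)
  finally show ?thesis .
qed

text \<open>
  The projector factors as \<open>P = (WC)^(k+2) Z\<close>, since the range of \<open>(WC)^k\<close> does not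
  change with two further factors. As \<open>(WC)^(k+2) = WCW \<cdot> C(WC)^k\<close> and
  \<open>C(WC)^k = (CW)^k C\<close>, the matrix \<open>C(WC)^k Z\<close> has both defining properties.
\<close>
lemma weighted_core_EP_exists: "\<exists>X. is_weighted_core_EP W C X"
proof -
  let ?k = "windex W C"
  let ?P = "orth_projector (mat_range (mat_power (W ** C) ?k))"
  have "mat_range ?P \<subseteq> mat_range (mat_power (W ** C) ?k)"
    using orth_projector_characterization(1)[OF subspace_mat_range, of "mat_power (W ** C) ?k"]
    by (auto simp: mat_range_def[of ?P])
  also have "\<dots> = mat_range (mat_power (W ** C) (2 + ?k))"
    by (rule mat_range_power_stable[symmetric]) (auto simp: windex_def)
  finally obtain Z where Z: "?P = mat_power (W ** C) (2 + ?k) ** Z"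
    using mat_range_subset_iff_factor by blast
  have comm: "C ** mat_power (W ** C) ?k = mat_power (C ** W) ?k ** C"
    by (rule mat_power_intertwine)
  have "is_weighted_core_EP W C (C ** mat_power (W ** C) ?k ** Z)"
    unfolding is_weighted_core_EP_def
  proof
    show "W ** C ** W ** (C ** mat_power (W ** C) ?k ** Z) = ?P"
      unfolding Z mat_power_add by (simp add: matrix_mul_assoc numeral_2_eq_2)
    show "mat_range (C ** mat_power (W ** C) ?k ** Z) \<subseteq> mat_range (mat_power (C ** W) ?k)"
      unfolding comm by (metis matrix_mul_assoc mat_range_mult_subset)
  qed
  then show ?thesis ..
qed

lemma weighted_core_EP_unique:
  "is_weighted_core_EP W C X \<Longrightarrow> is_weighted_core_EP W C Y \<Longrightarrow> X = Y"
  unfolding is_weighted_core_EP_def by (metis weighted_core_EP_determined)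

lemma weighted_core_EP_inverse: "is_weighted_core_EP W C (weighted_core_EP_inverse W C)"
  unfolding weighted_core_EP_inverse_def
  using weighted_core_EP_exists weighted_core_EP_unique by (metis theI)

section \<open>W-powers of the weighted core-EP inverse\<close>

context
  fixes A X :: "complex^'n^'q" and W :: "complex^'q^'n"
  assumes X: "is_weighted_core_EP W A X"
begin

text \<open>
  \<open>WAWX\<close> is the projector onto the range of \<open>(WA)^k\<close>, and this range contains the columns
  of \<open>WX\<close> because \<open>W(AW)^k = (WA)^k W\<close>.
\<close>
lemma projector_absorbs_weighted_core_EP: "W ** A ** W ** X ** W ** X = W ** X"
proof -
  let ?k = "windex W A"
  obtain Y where Y: "X = mat_power (A ** W) ?k ** Y"
    using X mat_range_subset_iff_factor unfolding is_weighted_core_EP_def by blast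
  have "W ** X = mat_power (W ** A) ?k ** (W ** Y)"
    unfolding Y by (simp add: matrix_mul_assoc mat_power_intertwine)
  then have "mat_range (W ** X) \<subseteq> mat_range (mat_power (W ** A) ?k)"
    by (simp add: mat_range_mult_subset)
  from orth_projector_mult_absorb[OF this] show ?thesis
    using X unfolding is_weighted_core_EP_def by (simp add: matrix_mul_assoc)
qed

text \<open>
  Both sides have their columns in the range of \<open>(AW)^k\<close>, so it suffices to compare their
  products with \<open>WAW\<close>, where the projector \<open>WAWX\<close> appears and is absorbed.
\<close>
lemma weighted_core_EP_cancel_AW: "A ** W ** X ** W ** X = X"
proof (rule weighted_core_EP_determined[of _ A W])
  let ?k = "windex W A"
  obtain Y where Y: "X = mat_power (A ** W) ?k ** Y"
    using X mat_range_subset_iff_factor unfolding is_weighted_core_EP_def by blast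
  have "A ** W ** mat_power (A ** W) ?k = mat_power (A ** W) ?k ** (A ** W)"
    by (metis mat_power.simps(2) mat_power_Suc_left)
  then have "A ** W ** X ** W ** X = mat_power (A ** W) ?k ** (A ** W ** Y ** W ** X)"
    by (subst Y) (simp add: matrix_mul_assoc)
  then show "mat_range (A ** W ** X ** W ** X) \<subseteq> mat_range (mat_power (A ** W) ?k)"
    by (simp add: mat_range_mult_subset)
  show "mat_range X \<subseteq> mat_range (mat_power (A ** W) ?k)"
    using X by (simp add: is_weighted_core_EP_def)
  have "W ** A ** W ** (A ** W ** X ** W ** X) = W ** A ** (W ** A ** W ** X ** W ** X)"
    by (simp add: matrix_mul_assoc)
  then show "W ** A ** W ** (A ** W ** X ** W ** X) = W ** A ** W ** X"
    by (simp add: projector_absorbs_weighted_core_EP matrix_mul_assoc)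
qed

lemma mat_power_mult_wpow_core_EP:
  "mat_power (A ** W) j ** wpow W X (Suc (l + j)) = wpow W X (Suc l)"
proof (induction j)
  case (Suc j)
  have "wpow W X (Suc (l + Suc j)) = X ** W ** X ** mat_power (W ** X) (l + j)"
    unfolding wpow_eq_mult_mat_power add_Suc_right mat_power_Suc_left by (simp add: matrix_mul_assoc)
  then have "A ** W ** wpow W X (Suc (l + Suc j)) = wpow W X (Suc (l + j))"
    unfolding wpow_eq_mult_mat_power by (simp add: matrix_mul_assoc weighted_core_EP_cancel_AW)
  then show ?case using Suc by (simp flip: matrix_mul_assoc)
qed simp

text \<open>
  With \<open>C\<close> the \<open>l\<close>-th W-power of \<open>A\<close>, cancellation leaves \<open>WCW\<close> times the \<open>l\<close>-th W-power
  of \<open>X\<close> equal to \<open>WAWX\<close>. The defining ranges agree on taking the exponent 1 for \<open>C\<close> and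
  the exponent \<open>l\<close> for \<open>A\<close>, since \<open>WC = (WA)^l\<close> and \<open>CW = (AW)^l\<close>.
\<close>
lemma is_weighted_core_EP_wpow:
  assumes "windex W A \<le> l" "l \<ge> 1"
  shows "windex W (wpow W A l) \<le> 1" "is_weighted_core_EP W (wpow W A l) (wpow W X l)"
proof -
  note pw = wpow_mult_weight[OF \<open>l \<ge> 1\<close>, of W A] weight_mult_wpow[OF \<open>l \<ge> 1\<close>, of W A]
  show idx: "windex W (wpow W A l) \<le> 1"
    using assms(1) mat_index_power_le_1[of "A ** W" l] mat_index_power_le_1[of "W ** A" l]
    by (simp add: windex_def pw)
  obtain j where l: "l = Suc j" using \<open>l \<ge> 1\<close> by (cases l) auto
  have "W ** wpow W A l ** W ** wpow W X l = W ** mat_power (A ** W) l ** wpow W X l"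
    by (simp add: pw mat_power_intertwine)
  also have "\<dots> = W ** (A ** W) ** (mat_power (A ** W) j ** wpow W X (Suc (0 + j)))"
    unfolding l mat_power_Suc_left by (simp add: matrix_mul_assoc)
  also have "\<dots> = W ** A ** W ** X"
    unfolding mat_power_mult_wpow_core_EP by (simp add: matrix_mul_assoc)
  finally have "W ** wpow W A l ** W ** wpow W X l = W ** A ** W ** X" .
  moreover have "mat_range (wpow W X l) \<subseteq> mat_range X"
    unfolding l wpow_eq_mult_mat_power by (rule mat_range_mult_subset)
  ultimately show "is_weighted_core_EP W (wpow W A l) (wpow W X l)"
    using X unfolding is_weighted_core_EP_iff[OF idx] is_weighted_core_EP_iff[OF assms(1)] pw
    by auto
qed

lemma weighted_core_inverse_wpow:
  assumes "windex W A \<le> l" "l \<ge> 1"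
  shows "weighted_core_inverse W (wpow W A l) = wpow W X l"
  unfolding weighted_core_inverse_def
  using is_weighted_core_EP_wpow[OF assms] weighted_core_EP_unique by (intro the_equality) auto

end

section \<open>Representations of the weighted weak group inverse\<close>

theorem theorem3p5:
  fixes A :: "complex^'n^'q" and W :: "complex^'q^'n" and m k :: nat
  assumes "W \<noteq> 0"
    and "m \<ge> 1"
    and "k = max (mat_index (A ** W)) (mat_index (W ** A))"
  shows "(k \<ge> m \<longrightarrow>
           weighted_weak_group_inverse m W A =
             wpow_times_W W A (k - m) ** weighted_core_inverse W (wpow W A (k + 1)) ** W ** wpow W A m) \<and>
         (k \<ge> m + 1 \<longrightarrow>
           weighted_weak_group_inverse m W A =
             wpow_times_W W A (k - m - 1) ** weighted_core_inverse W (wpow W A k) ** W ** wpow W A m)"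
proof -
  let ?X = "weighted_core_EP_inverse W A"
  have k: "windex W A = k" using assms by (simp add: windex_def)
  have reduce: "weighted_weak_group_inverse m W A =
      wpow_times_W W A (l - (m + 1)) ** weighted_core_inverse W (wpow W A l) ** W ** wpow W A m"
    if "k \<le> l" "m + 1 \<le> l" for l
  proof -
    have "weighted_core_inverse W (wpow W A l) = wpow W ?X l"
      using that k by (intro weighted_core_inverse_wpow[OF weighted_core_EP_inverse]) auto
    moreover have "mat_power (A ** W) (l - (m + 1)) ** wpow W ?X l = wpow W ?X (m + 1)"
      using that mat_power_mult_wpow_core_EP[OF weighted_core_EP_inverse,
          where A = A and W = W and l = m and j = "l - (m + 1)"]
      by simp
    ultimately show ?thesis
      by (simp add: weighted_weak_group_inverse_def wpow_times_W_eq_mat_power)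
  qed
  show ?thesis using reduce[of "k + 1"] reduce[of k] by simp
qed

end
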